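(* Let $G_n=G_n(g,zg)$ be an io-decomposable Riordan graph of the Bell type with $n\ge2$ vertices. Then $$i(G_n)\ge 2-\lceil\log_2 n\rceil+\sum_{j=1}^{\lceil\log_2 n\rceil}\left(2^{\alpha_j}+\frac{\alpha_{j+1}^2-\alpha_{j+1}}{2}\right),$$ where $\alpha_j=\left\lfloor\frac{n-1+2^{j-1}}{2^j}\right\rfloor$.
   Context: For a finite simple graph $G$, $i(G)$ is the number of independent sets of $G$ (sets of pairwise non-adjacent vertices), including the empty set. Riordan graph: let $g=\sum_{m\ge0}g_mz^m$ and $f=\sum_{m\ge1}f_mz^m$ be formal power series in $\mathbb{Z}[[z]]$, and let $[z^m]h$ denote the coefficient of $z^m$ in $h$. The Riordan graph $G_n(g,f)$ is the simple graph with vertex set $\{1,\ldots,n\}$ in which, for $i>j$, the vertices $i$ and $j$ are adjacent if and only if $[z^{i-2}]\,gf^{\,j-1}\equiv1\pmod2$. It is proper if $[z^0]g\equiv[z^1]f\equiv1\pmod2$. It is of the Bell type if $f=zg$. Let $\langle V_o\rangle$ and $\langle V_e\rangle$ be the subgraphs of $G_n(g,f)$ induced by the odd vertices and by the even vertices, respectively. A proper Riordan graph $G_n(g,f)$ is io-decomposable (isomorphically odd decomposable) if $\langle V_o\rangle\cong G_{\lceil n/2\rceil}(g,f)$ and $\langle V_e\rangle$ is a null graph (has no edges). *)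

theory Defs
  imports
    Complex_Main
    "HOL-Computational_Algebra.Formal_Power_Series"
    "HOL-Number_Theory.Cong"
    "Graph_Theory.Graph_Theory"
begin

text \<open>
  A simple graph is a symmetric loop-free digraph without parallel arcs (locale
  \<^locale>\<open>pair_graph\<close>): an edge between \<open>u\<close> and \<open>v\<close> is the pair of arcs
  \<open>(u, v)\<close> and \<open>(v, u)\<close>.
\<close>

definition independent_sets :: "('a, 'b) pre_digraph \<Rightarrow> 'a set set" where
  "independent_sets G = {S. S \<subseteq> verts G \<and> pairwise (\<lambda>u v. (u, v) \<notin> arcs_ends G) S}"

definition num_independent_sets :: "('a, 'b) pre_digraph \<Rightarrow> nat" where
  "num_independent_sets G = card (independent_sets G)"

text \<open>
  The power series \<open>f\<close> is meant to have constant term \<open>0\<close>.  For \<open>i > j \<ge> 1\<close>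
  the subtraction \<open>i - 2\<close> is not truncated, and likewise for \<open>j - 1\<close>.
\<close>

definition riordan_edge :: "int fps \<Rightarrow> int fps \<Rightarrow> nat \<Rightarrow> nat \<Rightarrow> bool" where
  "riordan_edge g f i j \<longleftrightarrow> i > j \<and> [fps_nth (g * f ^ (j - 1)) (i - 2) = 1] (mod 2)"

definition riordan_graph :: "nat \<Rightarrow> int fps \<Rightarrow> int fps \<Rightarrow> nat pair_pre_digraph" where
  "riordan_graph n g f =
     \<lparr> pverts = {1..n},
       parcs = {(i, j). i \<in> {1..n} \<and> j \<in> {1..n} \<and> (riordan_edge g f i j \<or> riordan_edge g f j i)} \<rparr>"

lemma pair_graph_riordan_graph: "pair_graph (riordan_graph n g f)"
proof
  have "parcs (riordan_graph n g f) \<subseteq> {1..n} \<times> {1..n}"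
    by (auto simp: riordan_graph_def)
  then show "finite (parcs (riordan_graph n g f))"
    by (rule finite_subset) auto
qed (auto simp: riordan_graph_def riordan_edge_def symmetric_def sym_def)

definition proper_riordan :: "int fps \<Rightarrow> int fps \<Rightarrow> bool" where
  "proper_riordan g f \<longleftrightarrow> [fps_nth g 0 = 1] (mod 2) \<and> [fps_nth f 1 = 1] (mod 2)"

definition odd_subgraph :: "nat \<Rightarrow> int fps \<Rightarrow> int fps \<Rightarrow> (nat, nat \<times> nat) pre_digraph" where
  "odd_subgraph n g f = with_proj (riordan_graph n g f) \<restriction> {v \<in> pverts (riordan_graph n g f). odd v}"

definition even_subgraph :: "nat \<Rightarrow> int fps \<Rightarrow> int fps \<Rightarrow> (nat, nat \<times> nat) pre_digraph" where
  "even_subgraph n g f = with_proj (riordan_graph n g f) \<restriction> {v \<in> pverts (riordan_graph n g f). even v}"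

definition io_decomposable :: "nat \<Rightarrow> int fps \<Rightarrow> int fps \<Rightarrow> bool" where
  "io_decomposable n g f \<longleftrightarrow>
     proper_riordan g f \<and>
     digraph_iso (odd_subgraph n g f) (with_proj (riordan_graph (nat \<lceil>real n / 2\<rceil>) g f)) \<and>
     arcs (even_subgraph n g f) = {}"

definition alpha :: "nat \<Rightarrow> nat \<Rightarrow> nat" where
  "alpha n j = nat \<lfloor>(real n - 1 + 2 ^ (j - 1)) / 2 ^ j\<rfloor>"

end

theory Submission
  imports Defs
begin

text \<open>
  The independent sets are counted by their largest vertex \<open>v\<close>.  Since \<open>g\<^sup>2 \<equiv> g(z\<^sup>2)\<close> modulo 2,
  even vertices are pairwise non-adjacent, and for \<open>p \<ge> q\<close> the vertices \<open>2\<^sup>s p + 1\<close> and \<open>2\<^sup>s q\<close> are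
  adjacent iff \<open>p + 1\<close> and \<open>q\<close> are.  Hence \<open>v = 2\<^sup>s (2 c + 1) + 1\<close> is not adjacent to any of the
  \<open>c\<close> smaller multiples of \<open>2\<^sup>s\<^sup>+\<^sup>1\<close>, which gives \<open>2\<^sup>c\<close> independent sets with maximum \<open>v\<close>.  The pairs
  \<open>(s, c)\<close> with \<open>v \<le> n\<close> are those with \<open>c < \<alpha>\<^sub>s\<^sub>+\<^sub>1\<close>, so these sets, the empty set and \<open>{1}\<close> account for
  all terms of the bound except the quadratic ones.

  If \<open>2 c + 2\<close> is not adjacent to some smaller odd vertex \<open>2 b + 1\<close>, then \<open>v\<close> is not adjacent to
  \<open>2\<^sup>s (2 b + 1)\<close> either, and for \<open>s \<ge> 1\<close> the number of sets with maximum \<open>v\<close> doubles.  Looking at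
  the coefficients of \<open>z\<^sup>1\<close>, \<open>z\<^sup>2\<close> and \<open>z\<^sup>4\<close> in \<open>g\<close> shows that this happens for all sufficiently large
  \<open>c\<close> of one parity, and the sets so gained outweigh the quadratic terms.
\<close>

section \<open>Parity of coefficients and adjacency among scaled vertices\<close>

text \<open>In the convolution the terms \<open>i\<close> and \<open>k - i\<close> agree and cancel
  modulo 2; only a middle term survives, and an integer has the parity of its square.\<close>

lemma fps_square_nth_parity:
  fixes f :: "int fps"
  shows "even (fps_nth (f\<^sup>2) k) \<longleftrightarrow> odd k \<or> even (fps_nth f (k div 2))"
proof -
  let ?h = "\<lambda>i. fps_nth f i * fps_nth f (k - i)"
  let ?A = "{i. 2 * i < k}" and ?B = "{i. i \<le> k \<and> k < 2 * i}" and ?C = "{i. 2 * i = k}"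
  have fin: "finite ?A" "finite ?B" "finite ?C"
    by (auto intro: finite_subset[of _ "{..k}"])
  have "sum ?h ?A = sum ?h ?B"
    by (rule sum.reindex_bij_witness[of _ "\<lambda>i. k - i" "\<lambda>i. k - i"]) (auto simp: mult.commute)
  moreover have "{0..k} = (?A \<union> ?B) \<union> ?C" by auto
  then have "sum ?h {0..k} = sum ?h (?A \<union> ?B) + sum ?h ?C"
    using fin by (simp only:) (rule sum.union_disjoint, auto)
  moreover have "sum ?h (?A \<union> ?B) = sum ?h ?A + sum ?h ?B"
    using fin by (intro sum.union_disjoint) auto
  ultimately have eq: "sum ?h {0..k} = 2 * sum ?h ?A + sum ?h ?C" by simp
  show ?thesis
  proof (cases "even k")
    case True
    then obtain m where k: "k = 2 * m" by blast
    then have "?C = {m}" by auto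
    with eq k show ?thesis by (simp add: power2_eq_square fps_mult_nth)
  next
    case False
    then have "?C = {}" by auto
    with eq False show ?thesis by (simp add: power2_eq_square fps_mult_nth)
  qed
qed

text \<open>Meaningful for \<open>i > j \<ge> 1\<close> only, because of the truncated subtraction.\<close>

definition bell_adj :: "int fps \<Rightarrow> nat \<Rightarrow> nat \<Rightarrow> bool" where
  "bell_adj g i j \<longleftrightarrow> odd (fps_nth (g ^ j) (i - j - 1))"

lemma riordan_edge_bell_iff:
  assumes "j \<ge> 1"
  shows "riordan_edge g (fps_X * g) i j \<longleftrightarrow> j < i \<and> bell_adj g i j"
proof -
  have "g * (fps_X * g) ^ (j - 1) = fps_X ^ (j - 1) * g ^ j"
    using assms by (cases j) (simp_all add: power_mult_distrib)
  moreover have "i - 2 - (j - 1) = i - j - 1" "\<not> i - 2 < j - 1" if "j < i"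
    using that assms by auto
  ultimately show ?thesis
    by (auto simp: riordan_edge_def bell_adj_def fps_X_power_mult_nth cong_def odd_iff_mod_2_eq_one)
qed

text \<open>\<open>g ^ (2 * q)\<close> is the square of \<open>g ^ q\<close>, and the index
  \<open>2 * (p - q)\<close> is even, so both halve.\<close>

lemma bell_adj_double:
  assumes "q \<le> p"
  shows "bell_adj g (2 * p + 1) (2 * q) \<longleftrightarrow> bell_adj g (p + 1) q"
proof -
  have "2 * p + 1 - 2 * q - 1 = 2 * (p - q)" "p + 1 - q - 1 = p - q" using assms by auto
  moreover have "g ^ (2 * q) = (g ^ q)\<^sup>2" by (simp add: power_even_eq)
  ultimately show ?thesis by (simp only: bell_adj_def fps_square_nth_parity) simp
qed

lemma bell_adj_power2:
  assumes "q \<le> p"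
  shows "bell_adj g (2 ^ s * p + 1) (2 ^ s * q) \<longleftrightarrow> bell_adj g (p + 1) q"
proof (induction s)
  case (Suc s)
  have "bell_adj g (2 * (2 ^ s * p) + 1) (2 * (2 ^ s * q)) \<longleftrightarrow>
      bell_adj g (2 ^ s * p + 1) (2 ^ s * q)"
    using assms by (intro bell_adj_double) simp
  with Suc show ?case by (simp add: mult.assoc)
qed simp

text \<open>The index \<open>i - j - 1\<close> is odd, and the square \<open>g ^ j\<close> has even
  coefficients at odd indices.\<close>

lemma not_bell_adj_even:
  assumes "even i" "even j" "j < i"
  shows "\<not> bell_adj g i j"
proof -
  obtain q where j: "j = 2 * q" using assms by blast
  have "g ^ j = (g ^ q)\<^sup>2" by (simp add: j power_even_eq)
  moreover have "odd (i - j - 1)" using assms by auto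
  ultimately show ?thesis by (simp only: bell_adj_def fps_square_nth_parity) simp
qed

section \<open>Adjacency at distances 2, 3 and 5\<close>

context
  fixes g :: "int fps"
  assumes g0: "odd (fps_nth g 0)"
begin

lemma odd_power_nth_0: "odd (fps_nth (g ^ m) 0)"
  using g0 by (simp add: fps_nth_power_0)

lemma odd_power_nth_1: "odd (fps_nth (g ^ m) 1) \<longleftrightarrow> odd m \<and> odd (fps_nth g 1)"
proof (induction m)
  case (Suc m)
  then show ?case using g0 odd_power_nth_0[of m] by (auto simp: fps_mult_nth)
qed simp

lemma odd_power_nth_2:
  assumes "even (fps_nth g 1)"
  shows "odd (fps_nth (g ^ m) 2) \<longleftrightarrow> odd m \<and> odd (fps_nth g 2)"
proof (induction m)
  case (Suc m)
  have "fps_nth (g ^ Suc m) 2 = fps_nth g 0 * fps_nth (g ^ m) 2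
     + fps_nth g 1 * fps_nth (g ^ m) 1 + fps_nth g 2 * fps_nth (g ^ m) 0"
    by (simp add: fps_mult_nth eval_nat_numeral)
  with Suc show ?case using g0 assms odd_power_nth_0[of m]
    by (auto simp del: power_Suc fps_power_zeroth)
qed simp

lemma bell_adj_dist_2: "bell_adj g (Suc (Suc j)) j \<longleftrightarrow> odd j \<and> odd (fps_nth g 1)"
  using odd_power_nth_1[of j] by (simp add: bell_adj_def)

text \<open>For \<open>c = m + 1\<close> this tests \<open>2 * c + 2\<close> against the candidate
  \<open>b = c - 1\<close>. In \<open>g * (g ^ m)\<^sup>2\<close> the square contributes modulo 2 at
  even indices only, which leaves \<open>fps_nth (g ^ m) 1 + fps_nth g 2\<close>.\<close>

lemma bell_adj_dist_3:
  "bell_adj g (2 * m + 4) (2 * m + 1) \<longleftrightarrow> odd (fps_nth g 2) \<noteq> (odd m \<and> odd (fps_nth g 1))"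
proof -
  have "g ^ (2 * m + 1) = g * (g ^ m)\<^sup>2" by (simp only: Suc_eq_plus1[symmetric] power_Suc power_even_eq)
  moreover have "2 * m + 4 - (2 * m + 1) - 1 = 2" by simp
  moreover have "fps_nth (g * (g ^ m)\<^sup>2) 2 = fps_nth g 0 * fps_nth ((g ^ m)\<^sup>2) 2
     + fps_nth g 1 * fps_nth ((g ^ m)\<^sup>2) 1 + fps_nth g 2 * fps_nth ((g ^ m)\<^sup>2) 0"
    by (simp add: fps_mult_nth eval_nat_numeral)
  ultimately have "bell_adj g (2 * m + 4) (2 * m + 1) \<longleftrightarrow> odd (fps_nth g 0 * fps_nth ((g ^ m)\<^sup>2) 2
     + fps_nth g 1 * fps_nth ((g ^ m)\<^sup>2) 1 + fps_nth g 2 * fps_nth ((g ^ m)\<^sup>2) 0)"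
    by (simp only: bell_adj_def)
  moreover have "odd (fps_nth ((g ^ m)\<^sup>2) 0)" "even (fps_nth ((g ^ m)\<^sup>2) 1)"
    "odd (fps_nth ((g ^ m)\<^sup>2) 2) \<longleftrightarrow> odd m \<and> odd (fps_nth g 1)"
    using odd_power_nth_0[of m] odd_power_nth_1[of m]
    by (simp_all add: fps_square_nth_parity del: fps_power_zeroth One_nat_def)
  ultimately show ?thesis
    using g0 by auto
qed

text \<open>The fallback candidate \<open>b = c - 2\<close>, for \<open>c = m + 2\<close>. As
  before, only even indices of the square matter; its coefficient at 2 also vanishes modulo 2
  because \<open>fps_nth g 1\<close> is even.\<close>

lemma bell_adj_dist_5:
  assumes "even (fps_nth g 1)"
  shows "bell_adj g (2 * m + 6) (2 * m + 1) \<longleftrightarrow>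
    odd (fps_nth g 4) \<noteq> (odd m \<and> odd (fps_nth g 2))"
proof -
  have "g ^ (2 * m + 1) = g * (g ^ m)\<^sup>2" by (simp only: Suc_eq_plus1[symmetric] power_Suc power_even_eq)
  moreover have "2 * m + 6 - (2 * m + 1) - 1 = 4" by simp
  moreover have "fps_nth (g * (g ^ m)\<^sup>2) 4 = fps_nth g 0 * fps_nth ((g ^ m)\<^sup>2) 4
     + fps_nth g 1 * fps_nth ((g ^ m)\<^sup>2) 3 + fps_nth g 2 * fps_nth ((g ^ m)\<^sup>2) 2
     + fps_nth g 3 * fps_nth ((g ^ m)\<^sup>2) 1 + fps_nth g 4 * fps_nth ((g ^ m)\<^sup>2) 0"
    by (simp add: fps_mult_nth eval_nat_numeral)
  ultimately have "bell_adj g (2 * m + 6) (2 * m + 1) \<longleftrightarrow> odd (fps_nth g 0 * fps_nth ((g ^ m)\<^sup>2) 4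
     + fps_nth g 1 * fps_nth ((g ^ m)\<^sup>2) 3 + fps_nth g 2 * fps_nth ((g ^ m)\<^sup>2) 2
     + fps_nth g 3 * fps_nth ((g ^ m)\<^sup>2) 1 + fps_nth g 4 * fps_nth ((g ^ m)\<^sup>2) 0)"
    by (simp only: bell_adj_def)
  moreover have "odd (fps_nth ((g ^ m)\<^sup>2) 0)" "even (fps_nth ((g ^ m)\<^sup>2) 1)" "even (fps_nth ((g ^ m)\<^sup>2) 3)"
    "even (fps_nth ((g ^ m)\<^sup>2) 2)" "odd (fps_nth ((g ^ m)\<^sup>2) 4) \<longleftrightarrow> odd m \<and> odd (fps_nth g 2)"
    using assms odd_power_nth_0[of m] odd_power_nth_1[of m] odd_power_nth_2[of m]
    by (simp_all add: fps_square_nth_parity del: fps_power_zeroth One_nat_def)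
  ultimately show ?thesis
    using g0 assms by auto
qed

end

section \<open>The numbers \<open>alpha\<close> as counts of vertices\<close>

text \<open>Thus \<open>alpha n (Suc s)\<close> counts the vertices \<open>v\<close> from 2 to
  \<open>n\<close> for which \<open>2 ^ s\<close> is the largest power of 2 dividing
  \<open>v - 1\<close>.\<close>

lemma alpha_less_iff:
  assumes "n \<ge> 1"
  shows "c < alpha n (Suc s) \<longleftrightarrow> 2 ^ s * (2 * c + 1) < n"
proof -
  have "(real n - 1 + 2 ^ s) / 2 ^ Suc s = real (n - 1 + 2 ^ s) / real (2 ^ Suc s)"
    using assms by (simp add: of_nat_diff)
  then have "alpha n (Suc s) = (n - 1 + 2 ^ s) div 2 ^ Suc s"
    unfolding alpha_def by (simp only: floor_divide_of_nat_eq diff_Suc_1 nat_int)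
  then have "c < alpha n (Suc s) \<longleftrightarrow> Suc c * 2 ^ Suc s \<le> n - 1 + 2 ^ s"
    by (simp only: Suc_le_eq[symmetric] less_eq_div_iff_mult_less_eq[OF zero_less_power[OF zero_less_numeral]])
  also have "\<dots> \<longleftrightarrow> 2 ^ s * (2 * c + 1) < n"
    using assms by (auto simp: algebra_simps)
  finally show ?thesis .
qed

text \<open>If \<open>c\<close> occurs at level \<open>Suc s\<close>, then \<open>2 * c\<close>
  occurs at level \<open>s\<close>, since
  \<open>2 ^ s * (4 * c + 1) < 2 ^ Suc s * (2 * c + 1)\<close>.\<close>

lemma alpha_Suc_le:
  assumes "n \<ge> 1"
  shows "2 * alpha n (Suc (Suc s)) \<le> alpha n (Suc s) + 1"
proof (cases "alpha n (Suc (Suc s))")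
  case (Suc c)
  then have "2 ^ Suc s * (2 * c + 1) < n" using alpha_less_iff[OF assms, of c "Suc s"] by simp
  then have "2 ^ s * (2 * (2 * c) + 1) < n" by (simp add: algebra_simps)
  then show ?thesis using alpha_less_iff[OF assms, of "2 * c" s] Suc by simp
qed simp

lemma odd_part_unique:
  fixes c d :: nat
  assumes "2 ^ s * (2 * c + 1) = 2 ^ t * (2 * d + 1)"
  shows "s = t \<and> c = d"
  using assms
proof (induction s arbitrary: t)
  case 0
  then show ?case by (cases t) (simp_all, presburger?)
next
  case (Suc s)
  show ?case
  proof (cases t)
    case 0
    then show ?thesis using Suc.prems by simp presburger
  next
    case (Suc t')
    then show ?thesis using Suc.IH[of t'] Suc.prems by simp
  qed
qed

section \<open>Surplus against the quadratic terms\<close>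

text \<open>\<open>y c\<close> stands for the surplus of sets beyond \<open>2 ^ c\<close>; the
  subtracted \<open>int c\<close> add up to the quadratic term. The exceptional bounds are the
  partial sums for \<open>y 0 = y 1 = y 3 = 0\<close> and \<open>y 2 = 4\<close>.\<close>

lemma sum_excess_even:
  fixes y :: "nat \<Rightarrow> int"
  assumes nonneg: "\<And>c. y c \<ge> 0" and large: "\<And>c. even c \<Longrightarrow> c \<ge> 2 \<Longrightarrow> y c \<ge> 2 ^ c"
  shows "(\<Sum>c<m. y c - int c) \<ge> (if m = 2 then - 1 else if m = 3 then 1 else if m = 4 then - 2 else 0)"
proof -
  \<comment> \<open>A sum ending in a large term keeps a reserve that pays for the next term, where
    \<open>y\<close> may be 0.\<close>
  have *: "(\<Sum>c<2 * j + 5. y c - int c) \<ge> int (2 * j + 5) \<and> (\<Sum>c<2 * j + 6. y c - int c) \<ge> 0" for j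
  proof (induction j)
    case 0
    have "y 2 \<ge> 4" "y 4 \<ge> 16" using large[of 2] large[of 4] by simp_all
    then show ?case
      using nonneg[of 0] nonneg[of 1] nonneg[of 3] nonneg[of 5]
      by (simp add: eval_nat_numeral)
  next
    case (Suc j)
    have "2 * (2 * i + 6) < (2 :: nat) ^ (2 * i + 6)" for i by (induction i) (simp_all add: power_add)
    from this[of j] have "int (2 * (2 * j + 6)) < int (2 ^ (2 * j + 6))" by (simp only: of_nat_less_iff)
    also have "int (2 ^ (2 * j + 6)) \<le> y (2 * j + 6)" using large[of "2 * j + 6"] by simp
    finally have y: "y (2 * j + 6) > int (2 * (2 * j + 6))" .
    have eqs: "2 * Suc j + 5 = Suc (2 * j + 6)" "2 * Suc j + 6 = Suc (Suc (2 * j + 6))" by simp_all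
    show ?case
      unfolding eqs sum.lessThan_Suc using Suc y nonneg[of "Suc (2 * j + 6)"] by simp
  qed
  consider "m = 0" | "m = 1" | "m = 2" | "m = 3" | "m = 4" | j where "m = 2 * j + 5" | j where "m = 2 * j + 6"
  proof -
    have "m \<le> 4 \<or> m = 2 * ((m - 5) div 2) + 5 \<or> m = 2 * ((m - 6) div 2) + 6" by presburger
    moreover have "m \<le> 4 \<Longrightarrow> m = 0 \<or> m = 1 \<or> m = 2 \<or> m = 3 \<or> m = 4" by auto
    ultimately show ?thesis using that by blast
  qed
  then show ?thesis
  proof cases
    case 6 then show ?thesis using *[of j] by simp
  next
    case 7 then show ?thesis using *[of j] by simp
  qed (use nonneg[of 0] nonneg[of 1] large[of 2] nonneg[of 3] in \<open>simp_all add: eval_nat_numeral\<close>)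
qed

text \<open>Large terms start only at 3. Until then \<open>small\<close> limits the loss to 1,
  reached at \<open>m = 3\<close>, and \<open>y 3 \<ge> 8\<close> more than repays it.\<close>

lemma sum_excess_odd:
  fixes y :: "nat \<Rightarrow> int"
  assumes nonneg: "\<And>c. y c \<ge> 0" and large: "\<And>c. odd c \<Longrightarrow> c \<ge> 3 \<Longrightarrow> y c \<ge> 2 ^ c"
    and small: "y 1 \<ge> 1" "y 1 + y 2 \<ge> 2"
  shows "(\<Sum>c<m. y c - int c) \<ge> (if m = 3 then - 1 else 0)"
proof -
  have *: "(\<Sum>c<2 * j + 4. y c - int c) \<ge> int (2 * j + 4) \<and> (\<Sum>c<2 * j + 5. y c - int c) \<ge> 0" for j
  proof (induction j)
    case 0
    have "y 3 \<ge> 8" using large[of 3] by simp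
    then show ?case
      using nonneg[of 0] small nonneg[of 4]
      by (simp add: eval_nat_numeral)
  next
    case (Suc j)
    have "2 * (2 * i + 5) < (2 :: nat) ^ (2 * i + 5)" for i by (induction i) (simp_all add: power_add)
    from this[of j] have "int (2 * (2 * j + 5)) < int (2 ^ (2 * j + 5))" by (simp only: of_nat_less_iff)
    also have "int (2 ^ (2 * j + 5)) \<le> y (2 * j + 5)" using large[of "2 * j + 5"] by simp
    finally have y: "y (2 * j + 5) > int (2 * (2 * j + 5))" .
    have eqs: "2 * Suc j + 4 = Suc (2 * j + 5)" "2 * Suc j + 5 = Suc (Suc (2 * j + 5))" by simp_all
    show ?case
      unfolding eqs sum.lessThan_Suc using Suc y nonneg[of "Suc (2 * j + 5)"] by simp
  qed
  consider "m = 0" | "m = 1" | "m = 2" | "m = 3" | j where "m = 2 * j + 4" | j where "m = 2 * j + 5"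
  proof -
    have "m \<le> 3 \<or> m = 2 * ((m - 4) div 2) + 4 \<or> m = 2 * ((m - 5) div 2) + 5" by presburger
    moreover have "m \<le> 3 \<Longrightarrow> m = 0 \<or> m = 1 \<or> m = 2 \<or> m = 3" by auto
    ultimately show ?thesis using that by blast
  qed
  then show ?thesis
  proof cases
    case 5 then show ?thesis using *[of j] by simp
  next
    case 6 then show ?thesis using *[of j] by simp
  qed (use nonneg[of 0] small in \<open>simp_all add: eval_nat_numeral\<close>)
qed

text \<open>
  Negative contributions come only from \<open>a s \<in> {2, 4}\<close> or \<open>a s = 3\<close>, and \<open>a\<close> roughly halves in each
  step; a potential function of \<open>a s\<close> therefore bounds their accumulated effect.
\<close>

lemma sum_ge_potential:
  fixes a :: "nat \<Rightarrow> nat" and E :: "nat \<Rightarrow> int"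
  assumes "t \<le> k"
    and "\<And>s. s < k \<Longrightarrow> P (a s) \<le> E s + P (a (Suc s))" and "\<And>m. P m \<le> (0 :: int)"
  shows "P (a t) \<le> (\<Sum>s=t..<k. E s)"
  using assms(1)
proof (induction rule: inc_induct)
  case (step s)
  then show ?case using assms(2)[of s] by (simp add: sum.atLeast_Suc_lessThan)
qed (use assms(3) in simp)

lemma sum_ge_sum_subset:
  fixes f :: "nat \<Rightarrow> int"
  assumes "\<And>c. f c \<ge> 0" "\<And>c. c \<in> A \<Longrightarrow> f c \<ge> 1" "A \<subseteq> {..<m}"
  shows "int (card A) \<le> sum f {..<m}"
proof -
  have "int (card A) = (\<Sum>c\<in>A. 1)" by simp
  also have "\<dots> \<le> sum f A" using assms(2) by (rule sum_mono)
  also have "\<dots> \<le> sum f {..<m}" using assms by (intro sum_mono2) auto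
  finally show ?thesis .
qed

text \<open>Level 0 carries no quadratic term, so its surplus can pay the debt of all later
  levels.\<close>

lemma excess_sum_nonneg_even:
  fixes x :: "nat \<Rightarrow> nat \<Rightarrow> int" and a :: "nat \<Rightarrow> nat"
  assumes nonneg: "\<And>s c. x s c \<ge> 0"
    and large: "\<And>s c. s \<ge> 1 \<Longrightarrow> even c \<Longrightarrow> c \<ge> 2 \<Longrightarrow> x s c \<ge> 2 ^ c"
    and level0: "\<And>c. even c \<Longrightarrow> c \<ge> 2 \<Longrightarrow> x 0 c \<ge> 1"
    and a: "\<And>s. 2 * a (Suc s) \<le> a s + 1" and "k \<ge> 1"
  shows "0 \<le> (\<Sum>c<a 0. x 0 c) + (\<Sum>s=1..<k. \<Sum>c<a s. x s c - int c)"
proof -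
  define E where "E = (\<lambda>s. if s = 0 then 0 else \<Sum>c<a s. x s c - int c)"
  \<comment> \<open>The value -3 combines the loss 2 at size 4 with the loss 1 at size 2, which may
    follow it. Larger sizes lose nothing themselves but may lead down to 4.\<close>
  define P where "P = (\<lambda>m::nat. if m \<ge> 4 then - 3 else if m \<ge> 2 then - 1 else (0::int))"
  have "P (a (Suc s)) \<le> E (Suc s) + P (a (Suc (Suc s)))" for s
    using sum_excess_even[of "x (Suc s)" "a (Suc s)"] nonneg large[of "Suc s"] a[of "Suc s"]
    by (auto simp: E_def P_def split: if_splits)
  then have "P (a (Suc 0)) \<le> (\<Sum>s=0..<k - 1. E (Suc s))"
    by (intro sum_ge_potential[where a = "\<lambda>s. a (Suc s)"]) (auto simp: P_def)
  also have "\<dots> = (\<Sum>s=Suc 0..<Suc (k - 1). E s)" by (rule sum.shift_bounds_Suc_ivl[symmetric])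
  also have "\<dots> = (\<Sum>s=1..<k. \<Sum>c<a s. x s c - int c)"
    using \<open>k \<ge> 1\<close> by (intro sum.cong) (auto simp: E_def)
  finally have 1: "P (a 1) \<le> (\<Sum>s=1..<k. \<Sum>c<a s. x s c - int c)" by simp
  have "- P (a 1) \<le> (\<Sum>c<a 0. x 0 c)"
  proof (cases "a 1 \<ge> 4")
    case True
    \<comment> \<open>\<open>a 1 \<ge> 4\<close> forces \<open>a 0 \<ge> 7\<close>, which makes
      three surplus terms available.\<close>
    then have "{2, 4, 6} \<subseteq> {..<a 0}" using a[of 0] by auto
    then have "int (card {2, 4, 6 :: nat}) \<le> sum (x 0) {..<a 0}"
      using nonneg level0 by (intro sum_ge_sum_subset) auto
    with True show ?thesis by (simp add: P_def)
  next
    case False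
    show ?thesis
    proof (cases "a 1 \<ge> 2")
      case True
      then have "{2} \<subseteq> {..<a 0}" using a[of 0] by auto
      then have "int (card {2 :: nat}) \<le> sum (x 0) {..<a 0}"
        using nonneg level0 by (intro sum_ge_sum_subset) auto
      with True False show ?thesis by (simp add: P_def)
    qed (use nonneg in \<open>simp add: P_def sum_nonneg\<close>)
  qed
  with 1 show ?thesis by linarith
qed

lemma excess_sum_nonneg_odd:
  fixes x :: "nat \<Rightarrow> nat \<Rightarrow> int" and a :: "nat \<Rightarrow> nat"
  assumes nonneg: "\<And>s c. x s c \<ge> 0"
    and large: "\<And>s c. s \<ge> 1 \<Longrightarrow> odd c \<Longrightarrow> c \<ge> 3 \<Longrightarrow> x s c \<ge> 2 ^ c"
    and small: "\<And>s. s \<ge> 1 \<Longrightarrow> x s 1 \<ge> 1" "\<And>s. s \<ge> 1 \<Longrightarrow> x s 1 + x s 2 \<ge> 2"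
    and level0: "x 0 3 \<ge> 1"
    and a: "\<And>s. 2 * a (Suc s) \<le> a s + 1" and "k \<ge> 1"
  shows "0 \<le> (\<Sum>c<a 0. x 0 c) + (\<Sum>s=1..<k. \<Sum>c<a s. x s c - int c)"
proof -
  define E where "E = (\<lambda>s. if s = 0 then 0 else \<Sum>c<a s. x s c - int c)"
  \<comment> \<open>Only size 3 can lose, and the next size is then at most 2, so the total debt is
    at most 1.\<close>
  define P where "P = (\<lambda>m::nat. if m \<ge> 3 then - 1 else (0::int))"
  have "P (a (Suc s)) \<le> E (Suc s) + P (a (Suc (Suc s)))" for s
    using sum_excess_odd[of "x (Suc s)" "a (Suc s)"] nonneg large[of "Suc s"] small[of "Suc s"]
      a[of "Suc s"]
    by (auto simp: E_def P_def split: if_splits)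
  then have "P (a (Suc 0)) \<le> (\<Sum>s=0..<k - 1. E (Suc s))"
    by (intro sum_ge_potential[where a = "\<lambda>s. a (Suc s)"]) (auto simp: P_def)
  also have "\<dots> = (\<Sum>s=Suc 0..<Suc (k - 1). E s)" by (rule sum.shift_bounds_Suc_ivl[symmetric])
  also have "\<dots> = (\<Sum>s=1..<k. \<Sum>c<a s. x s c - int c)"
    using \<open>k \<ge> 1\<close> by (intro sum.cong) (auto simp: E_def)
  finally have 1: "P (a 1) \<le> (\<Sum>s=1..<k. \<Sum>c<a s. x s c - int c)" by simp
  have "- P (a 1) \<le> (\<Sum>c<a 0. x 0 c)"
  proof (cases "a 1 \<ge> 3")
    case True
    then have "{3} \<subseteq> {..<a 0}" using a[of 0] by auto
    then have "int (card {3 :: nat}) \<le> sum (x 0) {..<a 0}"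
      using nonneg level0 by (intro sum_ge_sum_subset) auto
    with True show ?thesis by (simp add: P_def)
  qed (use nonneg in \<open>simp add: P_def sum_nonneg\<close>)
  with 1 show ?thesis by linarith
qed

section \<open>Independent sets with a given maximum\<close>

text \<open>Adjacency of two vertices does not depend on \<open>n\<close>, so neither does this
  family.\<close>

definition independent_sets_max :: "int fps \<Rightarrow> nat \<Rightarrow> nat set set" where
  "independent_sets_max g v =
     {S. S \<subseteq> {1..v} \<and> v \<in> S \<and> (\<forall>i\<in>S. \<forall>j\<in>S. j < i \<longrightarrow> \<not> bell_adj g i j)}"

lemma finite_independent_sets_max: "finite (independent_sets_max g v)"
  by (rule finite_subset[of _ "Pow {1..v}"]) (auto simp: independent_sets_max_def)

lemma num_independent_sets_bell_ge:
  "num_independent_sets (with_proj (riordan_graph n g (fps_X * g))) \<ge>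
     1 + (\<Sum>v=1..n. card (independent_sets_max g v))"
proof -
  let ?G = "with_proj (riordan_graph n g (fps_X * g))"
  let ?U = "\<Union>v\<in>{1..n}. independent_sets_max g v"
  have fin: "finite ?U" by (simp add: finite_independent_sets_max)
  have "independent_sets ?G \<subseteq> Pow {1..n}"
    by (auto simp: independent_sets_def riordan_graph_def)
  then have fin': "finite (independent_sets ?G)" by (rule finite_subset) simp
  have "insert {} ?U \<subseteq> independent_sets ?G"
    by (auto simp: independent_sets_def independent_sets_max_def riordan_graph_def pairwise_def
        riordan_edge_bell_iff subset_iff intro: order_trans)
  then have "card (insert {} ?U) \<le> card (independent_sets ?G)"
    using fin' by (rule card_mono[rotated])
  moreover have "{} \<notin> ?U" by (auto simp: independent_sets_max_def)
  moreover have "card ?U = (\<Sum>v=1..n. card (independent_sets_max g v))"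
  proof (rule card_UN_disjoint)
    show "\<forall>v\<in>{1..n}. \<forall>w\<in>{1..n}. v \<noteq> w \<longrightarrow>
        independent_sets_max g v \<inter> independent_sets_max g w = {}"
      by (auto simp: independent_sets_max_def subset_iff) (meson order.antisym)
  qed (auto simp: finite_independent_sets_max)
  ultimately show ?thesis using fin by (simp add: num_independent_sets_def)
qed

text \<open>Even vertices are pairwise non-adjacent, so every subset of \<open>W\<close> can be
  joined with \<open>v\<close>. An odd \<open>u\<close> lies outside \<open>W\<close>, hence
  \<open>{v, u}\<close> is a further set.\<close>

lemma
  assumes "v \<ge> 1" and W: "W \<subseteq> {1..<v}" "\<And>w. w \<in> W \<Longrightarrow> even w \<and> \<not> bell_adj g v w"
  shows card_independent_sets_max_ge: "2 ^ card W \<le> card (independent_sets_max g v)"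
    and card_independent_sets_max_gt: "u \<in> {1..<v} \<Longrightarrow> odd u \<Longrightarrow> \<not> bell_adj g v u \<Longrightarrow>
      2 ^ card W + 1 \<le> card (independent_sets_max g v)"
proof -
  have finW: "finite W" using W(1) by (rule finite_subset) simp
  have sub: "insert v ` Pow W \<subseteq> independent_sets_max g v"
  proof (rule image_subsetI)
    fix T assume T: "T \<in> Pow W"
    have "\<not> bell_adj g i j" if ij: "i \<in> insert v T" "j \<in> insert v T" "j < i" for i j
    proof -
      from T W have w: "w < v" "even w" "\<not> bell_adj g v w" if "w \<in> T" for w using that by auto
      from ij w(1)[of i] have "j \<in> T" by auto
      with ij w show ?thesis using not_bell_adj_even by blast
    qed
    moreover have "insert v T \<subseteq> {1..v}" using T W(1) \<open>v \<ge> 1\<close> by auto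
    ultimately show "insert v T \<in> independent_sets_max g v"
      by (simp add: independent_sets_max_def)
  qed
  have "v \<notin> W" using W(1) by auto
  then have "inj_on (insert v) (Pow W)" by (auto simp: inj_on_def)
  then have card: "card (insert v ` Pow W) = 2 ^ card W"
    using finW by (simp add: card_image card_Pow)
  then show "2 ^ card W \<le> card (independent_sets_max g v)"
    using card_mono[OF finite_independent_sets_max sub] by simp
  assume u: "u \<in> {1..<v}" "odd u" "\<not> bell_adj g v u"
  have "{v, u} \<in> independent_sets_max g v"
    using u by (auto simp: independent_sets_max_def)
  with sub have "insert {v, u} (insert v ` Pow W) \<subseteq> independent_sets_max g v" by simp
  then have "card (insert {v, u} (insert v ` Pow W)) \<le> card (independent_sets_max g v)"
    by (rule card_mono[OF finite_independent_sets_max])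
  moreover have "{v, u} \<notin> insert v ` Pow W"
  proof
    assume "{v, u} \<in> insert v ` Pow W"
    with u have "u \<in> W" by auto
    with W(2) u show False by blast
  qed
  ultimately show "2 ^ card W + 1 \<le> card (independent_sets_max g v)"
    using card finW by simp
qed

text \<open>Each vertex above 1 has exactly one pair \<open>(s, c)\<close>, which serves as its
  coordinates.\<close>

abbreviation card_max :: "int fps \<Rightarrow> nat \<Rightarrow> nat \<Rightarrow> nat" where
  "card_max g s c \<equiv> card (independent_sets_max g (2 ^ s * (2 * c + 1) + 1))"

lemma bell_adj_multiple:
  assumes "b \<in> {1..c}"
  shows "\<not> bell_adj g (2 ^ s * (2 * c + 1) + 1) (2 ^ s * (2 * b))"
proof -
  have "bell_adj g (2 ^ s * (2 * c + 1) + 1) (2 ^ s * (2 * b)) \<longleftrightarrow> bell_adj g (2 * c + 1 + 1) (2 * b)"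
    using assms by (intro bell_adj_power2) auto
  then show ?thesis using not_bell_adj_even[of "2 * c + 1 + 1" "2 * b" g] assms by simp
qed

text \<open>The doubling adds \<open>2 ^ s * (2 * b + 1)\<close> to the usable even vertices. For
  \<open>s = 0\<close> that vertex is odd, and only the gain of one set is available.\<close>

lemma card_max_ge: "2 ^ c \<le> card_max g s c"
  and card_max_gt_of_odd: "u < 2 ^ s * (2 * c + 1) + 1 \<Longrightarrow> odd u \<Longrightarrow>
    \<not> bell_adj g (2 ^ s * (2 * c + 1) + 1) u \<Longrightarrow> 2 ^ c + 1 \<le> card_max g s c"
  and card_max_ge_double: "b < c \<Longrightarrow> \<not> bell_adj g (2 * c + 2) (2 * b + 1) \<Longrightarrow> s \<ge> 1 \<Longrightarrow>
    2 ^ (c + 1) \<le> card_max g s c"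
proof -
  let ?v = "2 ^ s * (2 * c + 1) + 1"
  define W where "W = (\<lambda>b. 2 ^ s * (2 * b)) ` {1..c}"
  have card: "card W = c" by (simp add: W_def card_image inj_on_def)
  have W: "W \<subseteq> {1..<?v}" "\<And>w. w \<in> W \<Longrightarrow> even w \<and> \<not> bell_adj g ?v w"
  proof -
    have "2 ^ s * (2 * b) < ?v" if "b \<le> c" for b
      using mult_le_mono2[of "2 * b" "2 * c + 1" "2 ^ s"] that by simp
    then show "W \<subseteq> {1..<?v}" by (auto simp: W_def)
    show "\<And>w. w \<in> W \<Longrightarrow> even w \<and> \<not> bell_adj g ?v w"
      using bell_adj_multiple by (auto simp: W_def)
  qed
  show "2 ^ c \<le> card_max g s c" using card_independent_sets_max_ge[OF _ W] card by simp
  show "2 ^ c + 1 \<le> card_max g s c" if "u < ?v" "odd u" "\<not> bell_adj g ?v u"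
    using card_independent_sets_max_gt[OF _ W, of u] card that by (cases u) simp_all
  assume b: "b < c" "\<not> bell_adj g (2 * c + 2) (2 * b + 1)" "s \<ge> 1"
  let ?u = "2 ^ s * (2 * b + 1)"
  have "\<not> bell_adj g ?v ?u"
    using b by (subst bell_adj_power2) simp_all
  moreover have "even ?u" using b by simp
  moreover have "?u \<in> {1..<?v}"
  proof -
    have "?u < 2 ^ s * (2 * c + 1)" using b by (intro mult_strict_left_mono) auto
    then have "?u < ?v" by (simp only: Suc_eq_plus1[symmetric] less_SucI)
    moreover have "0 < ?u" by simp
    ultimately show ?thesis by (simp only: atLeastLessThan_iff One_nat_def Suc_le_eq simp_thms)
  qed
  ultimately have W': "insert ?u W \<subseteq> {1..<?v}"
    "\<And>w. w \<in> insert ?u W \<Longrightarrow> even w \<and> \<not> bell_adj g ?v w"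
    using W by auto
  have "?u \<notin> W"
  proof
    assume "?u \<in> W"
    then obtain d where "2 ^ s * (2 * b + 1) = 2 ^ s * (2 * d)" by (auto simp only: W_def)
    then have "2 * b + 1 = 2 * d" by (subst (asm) mult_cancel_left) simp
    then show False by presburger
  qed
  then have "card (insert ?u W) = c + 1" using card by (simp add: W_def)
  then show "2 ^ (c + 1) \<le> card_max g s c" using card_independent_sets_max_ge[OF _ W'] by simp
qed

section \<open>Summation over all vertices\<close>

text \<open>The summand 2 stands for the empty set and \<open>{1}\<close>, as vertex 1 has no
  coordinates \<open>(s, c)\<close>.\<close>

lemma sum_card_max_le:
  assumes "n \<ge> 1"
  shows "2 + (\<Sum>s<k. \<Sum>c<alpha n (Suc s). card_max g s c)
    \<le> num_independent_sets (with_proj (riordan_graph n g (fps_X * g)))"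
proof -
  let ?I = "Sigma {..<k} (\<lambda>s. {..<alpha n (Suc s)})"
  let ?v = "\<lambda>(s, c). 2 ^ s * (2 * c + 1) + 1 :: nat"
  let ?F = "\<lambda>v. card (independent_sets_max g v)"
  have "(s, c) = (t, d)" if "?v (s, c) = ?v (t, d)" for s c t d
    using odd_part_unique[of s c t d] that by simp
  then have inj: "inj_on ?v ?I" by (intro inj_onI) (metis surj_pair)
  have "?v ` ?I \<subseteq> {2..n}"
  proof (rule image_subsetI)
    fix p assume "p \<in> ?I"
    then obtain s c where p: "p = (s, c)" "c < alpha n (Suc s)" by auto
    then have "2 ^ s * (2 * c + 1) < n" using alpha_less_iff[OF assms] by simp
    moreover have "0 < 2 ^ s * (2 * c + 1)" by simp
    ultimately show "?v p \<in> {2..n}"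
      unfolding p(1) prod.case atLeastAtMost_iff by linarith
  qed
  have "{1} \<in> independent_sets_max g 1" by (auto simp: independent_sets_max_def)
  then have "card {{1 :: nat}} \<le> ?F 1"
    by (intro card_mono finite_independent_sets_max) simp
  then have "1 \<le> ?F 1" by simp
  have "(\<Sum>s<k. \<Sum>c<alpha n (Suc s). card_max g s c) = (\<Sum>p\<in>?I. ?F (?v p))"
    by (simp add: sum.Sigma split_def)
  also have "\<dots> = sum ?F (?v ` ?I)" using inj by (simp add: sum.reindex)
  also have "\<dots> \<le> sum ?F {2..n}" using \<open>?v ` ?I \<subseteq> {2..n}\<close> by (intro sum_mono2) auto
  finally have "2 + (\<Sum>s<k. \<Sum>c<alpha n (Suc s). card_max g s c) \<le> 1 + (?F 1 + sum ?F {2..n})"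
    using \<open>1 \<le> ?F 1\<close> by linarith
  also have "?F 1 + sum ?F {2..n} = sum ?F {1..n}"
    using assms by (simp add: sum.atLeast_Suc_atMost numeral_2_eq_2)
  finally show ?thesis using num_independent_sets_bell_ge[of g n] by linarith
qed

lemma sum_card_max_ge:
  assumes g0: "odd (fps_nth g 0)" and n: "n \<ge> 1" and k: "k \<ge> 1"
  shows "(\<Sum>s<k. 2 ^ alpha n (Suc s) - 1) + (\<Sum>s=1..<k. \<Sum>c<alpha n (Suc s). int c)
    \<le> int (\<Sum>s<k. \<Sum>c<alpha n (Suc s). card_max g s c)"
proof -
  define a where "a = (\<lambda>s. alpha n (Suc s))"
  define x where "x = (\<lambda>s c. int (card_max g s c) - 2 ^ c)"
  have a: "2 * a (Suc s) \<le> a s + 1" for s using alpha_Suc_le[OF n] by (simp add: a_def)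
  have x_ge: "x s c \<ge> int m" if "2 ^ c + m \<le> card_max g s c" for s c m
  proof -
    have "int (2 ^ c + m) \<le> int (card_max g s c)" using that by (simp only: of_nat_le_iff)
    then show ?thesis by (simp add: x_def)
  qed
  have nonneg: "x s c \<ge> 0" for s c using x_ge[of c 0 s] card_max_ge by simp
  have good: "x s c \<ge> 2 ^ c" if "b < c" "\<not> bell_adj g (2 * c + 2) (2 * b + 1)" "s \<ge> 1" for s b c
    using x_ge[of c "2 ^ c" s] card_max_ge_double[OF that] by simp
  have good0: "x 0 c \<ge> 1" if "b < c" "\<not> bell_adj g (2 * c + 2) (2 * b + 1)" for b c
    using x_ge[of c 1 0] card_max_gt_of_odd[of "2 * b + 1" 0 c g] that by simp
  have "0 \<le> (\<Sum>c<a 0. x 0 c) + (\<Sum>s=1..<k. \<Sum>c<a s. x s c - int c)"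
  \<comment> \<open>Under this condition odd \<open>c\<close> gain, otherwise even \<open>c\<close>.
    The candidate \<open>b = c - 1\<close> decides unless \<open>fps_nth g 1\<close> is even and
    \<open>fps_nth g 2\<close> odd; then it is always adjacent and \<open>b = c - 2\<close> takes
    over.\<close>
  proof (cases "odd (fps_nth g 1) \<and> even (fps_nth g 2) \<or>
      even (fps_nth g 1) \<and> odd (fps_nth g 2) \<and> odd (fps_nth g 4)")
    case False
    have *: "\<exists>b<c. \<not> bell_adj g (2 * c + 2) (2 * b + 1)" if c: "even c" "c \<ge> 2" for c
    proof (cases "odd (fps_nth g 1) \<or> even (fps_nth g 2)")
      case True
      obtain m where "c = Suc m" using c by (cases c) auto
      then have "2 * c + 2 = 2 * m + 4" by simp
      then have "\<not> bell_adj g (2 * c + 2) (2 * m + 1)"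
        using True False c \<open>c = Suc m\<close> by (simp only: bell_adj_dist_3[OF g0]) auto
      then show ?thesis using \<open>c = Suc m\<close> by blast
    next
      case g: False
      obtain m where "c = m + 2" using c by (metis le_add_diff_inverse2)
      then have "2 * c + 2 = 2 * m + 6" by simp
      then have "\<not> bell_adj g (2 * c + 2) (2 * m + 1)"
        using bell_adj_dist_5[OF g0, of m] g False c \<open>c = m + 2\<close> by (simp only:) auto
      then show ?thesis using \<open>c = m + 2\<close> by (intro exI[of _ m]) simp
    qed
    show ?thesis
    proof (rule excess_sum_nonneg_even[where x = x and a = a, OF nonneg _ _ a k])
      show "2 ^ c \<le> x s c" if "s \<ge> 1" "even c" "c \<ge> 2" for s c
        using *[OF that(2,3)] good that(1) by blast
      show "1 \<le> x 0 c" if "even c" "c \<ge> 2" for c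
        using *[OF that] good0 by blast
    qed
  next
    case True
    have *: "\<exists>b<c. \<not> bell_adj g (2 * c + 2) (2 * b + 1)"
      \<comment> \<open>For \<open>c = 1\<close> there is no \<open>b = c - 2\<close>, so only the
        case of odd \<open>fps_nth g 1\<close> covers it.\<close>
      if c: "odd c" "c \<ge> 3 \<or> odd (fps_nth g 1)" for c
    proof (cases "odd (fps_nth g 1)")
      case g: True
      obtain m where "c = Suc m" using c by (cases c) auto
      then have "2 * c + 2 = 2 * m + 4" by simp
      then have "\<not> bell_adj g (2 * c + 2) (2 * m + 1)"
        using True g c \<open>c = Suc m\<close> by (simp only: bell_adj_dist_3[OF g0]) auto
      then show ?thesis using \<open>c = Suc m\<close> by blast
    next
      case g: False
      with c have "c \<ge> 2" by simp
      then obtain m where "c = m + 2" by (metis le_add_diff_inverse2)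
      then have "2 * c + 2 = 2 * m + 6" by simp
      then have "\<not> bell_adj g (2 * c + 2) (2 * m + 1)"
        using bell_adj_dist_5[OF g0, of m] g True c \<open>c = m + 2\<close> by (simp only:) auto
      then show ?thesis using \<open>c = m + 2\<close> by (intro exI[of _ m]) simp
    qed
    have small: "x s 1 \<ge> 1 \<and> x s 1 + x s 2 \<ge> 2" if "s \<ge> 1" for s
    proof (cases "odd (fps_nth g 1)")
      case True
      then have "x s 1 \<ge> 2" using good[of _ 1 s] *[of 1] that by auto
      then show ?thesis using nonneg[of s 2] by linarith
    next
      case False
      \<comment> \<open>With \<open>fps_nth g 1\<close> even, no two vertices at distance 2 are
        adjacent. For \<open>s \<ge> 1\<close> the vertex \<open>j\<close>, two below the maximum,
        is odd and gives one extra set.\<close>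
      have "x s c \<ge> 1" for c
      proof -
        define j where "j = 2 ^ s * (2 * c + 1) - 1"
        have j: "2 ^ s * (2 * c + 1) = Suc j" by (simp add: j_def)
        moreover have "even (Suc j)" using that by (simp flip: j)
        ultimately show ?thesis
          using x_ge[of c 1 s] card_max_gt_of_odd[of j s c g] bell_adj_dist_2[OF g0, of j] False
          by simp
      qed
      from this[of 1] this[of 2] show ?thesis by linarith
    qed
    show ?thesis
    proof (rule excess_sum_nonneg_odd[where x = x and a = a, OF nonneg _ _ _ _ a k])
      show "2 ^ c \<le> x s c" if "s \<ge> 1" "odd c" "c \<ge> 3" for s c
        using *[of c] good that by blast
      show "1 \<le> x 0 3" using *[of 3] good0 by auto
    qed (use small in blast)+
  qed
  moreover have "int (\<Sum>s<k. \<Sum>c<a s. card_max g s c) = (\<Sum>s<k. \<Sum>c<a s. 2 ^ c + x s c)"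
    by (simp add: x_def)
  moreover have "\<dots> = (\<Sum>s<k. 2 ^ a s - 1) + (\<Sum>s<k. \<Sum>c<a s. x s c)"
  proof -
    have "(\<Sum>c<m. 2 ^ c) = 2 ^ m - (1 :: int)" for m by (induction m) auto
    then show ?thesis by (simp add: sum.distrib)
  qed
  moreover have "(\<Sum>s<k. \<Sum>c<a s. x s c) = (\<Sum>c<a 0. x 0 c) + (\<Sum>s=1..<k. \<Sum>c<a s. x s c)"
    using k by (simp add: sum.atLeast_Suc_lessThan flip: atLeast0LessThan)
  moreover have "(\<Sum>s=1..<k. \<Sum>c<a s. x s c - int c) =
      (\<Sum>s=1..<k. \<Sum>c<a s. x s c) - (\<Sum>s=1..<k. \<Sum>c<a s. int c)"
    by (simp add: sum_subtractf)
  ultimately show ?thesis unfolding a_def by linarith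
qed

theorem theorem3p14:
  fixes g :: "int fps" and n :: nat
  assumes "n \<ge> 2"
    and "io_decomposable n g (fps_X * g)"
  shows "real (num_independent_sets (with_proj (riordan_graph n g (fps_X * g)))) \<ge>
    2 - real_of_int \<lceil>log 2 (real n)\<rceil> +
    (\<Sum>j = 1..nat \<lceil>log 2 (real n)\<rceil>.
       2 ^ alpha n j + (real (alpha n (j + 1)) ^ 2 - real (alpha n (j + 1))) / 2)"
proof -
  define k where "k = nat \<lceil>log 2 (real n)\<rceil>"
  define T where "T = (\<lambda>m::nat. (real m ^ 2 - real m) / 2)"
  have log: "log 2 (real n) \<ge> 1" using assms(1) by simp
  then have k: "k \<ge> 1" "real k = real_of_int \<lceil>log 2 (real n)\<rceil>"
    by (simp_all add: k_def le_nat_iff)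
  have "log 2 (real n) \<le> real k" unfolding k(2) by (rule le_of_int_ceiling)
  then have "real n \<le> 2 powr real k" using assms(1) by (simp add: log_le_iff)
  then have "real n \<le> real (2 ^ k)" by (simp add: powr_realpow)
  then have "n \<le> 2 ^ k" by (simp only: of_nat_le_iff)
  \<comment> \<open>Level \<open>k\<close> is empty, so the quadratic term for \<open>j = k\<close>
    in the bound vanishes; this reconciles the ranges \<open>1..<k\<close> and
    \<open>1..k\<close>.\<close>
  then have last: "alpha n (Suc k) = 0"
    using alpha_less_iff[of n 0 k] assms(1) by simp
  have g0: "odd (fps_nth g 0)"
    using assms(2) by (auto simp: io_decomposable_def proper_riordan_def cong_def odd_iff_mod_2_eq_one)
  have T: "real_of_int (\<Sum>c<m. int c) = T m" for m
    by (induction m) (simp_all add: T_def power2_eq_square field_simps)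
  have "real_of_int (2 + ((\<Sum>s<k. 2 ^ alpha n (Suc s) - 1) + (\<Sum>s=1..<k. \<Sum>c<alpha n (Suc s). int c)))
      \<le> real_of_int (int (num_independent_sets (with_proj (riordan_graph n g (fps_X * g)))))"
    using sum_card_max_ge[OF g0 _ k(1), of n] sum_card_max_le[where n = n and k = k and g = g] assms(1)
    by (simp only: of_int_le_iff) linarith
  also have "real_of_int (2 + ((\<Sum>s<k. 2 ^ alpha n (Suc s) - 1) + (\<Sum>s=1..<k. \<Sum>c<alpha n (Suc s). int c)))
      = 2 + ((\<Sum>s<k. 2 ^ alpha n (Suc s)) - real k + (\<Sum>s=1..<k. T (alpha n (Suc s))))"
    unfolding of_int_add of_int_sum[of _ "{1..<k}"] T by (simp add: sum_subtractf)
  also have "(\<Sum>s<k. 2 ^ alpha n (Suc s)) = (\<Sum>j=1..k. 2 ^ alpha n j :: real)"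
    by (simp add: sum.atLeast1_atMost_eq)
  also have "(\<Sum>s=1..<k. T (alpha n (Suc s))) = (\<Sum>j=1..k. T (alpha n (j + 1)))"
  proof -
    have "{1..k} = insert k {1..<k}" using k(1) by auto
    then show ?thesis by (simp add: last T_def)
  qed
  finally show ?thesis using k(2) unfolding k_def T_def by (simp add: sum.distrib)
qed

end
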